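(* Suppose $D$ is an MBQC-form ZX-diagram that contains two adjacent $XY$-measured vertices $a,b$ with angles $\alpha_1,\alpha_2$ respectively. Let $D'$ be the diagram obtained by removing the edge $\{a,b\}$, replacing it by a path $a - x - y - t - b$ through three new non-input, non-output $XY$-measured vertices $x,y,t$ with angles $\beta_1,\beta_2,\beta_3\in[0,2\pi)$ respectively, and changing the angles of $a$ and $b$ to $0$. Here $$z:=-\sin\Big(\frac{\alpha_1+\alpha_2}{2}\Big)+i\cos\Big(\frac{\alpha_1-\alpha_2}{2}\Big),\qquad z':=\cos\Big(\frac{\alpha_1+\alpha_2}{2}\Big)-i\sin\Big(\frac{\alpha_1-\alpha_2}{2}\Big),$$ and (modulo $2\pi$): if $z'=0$ then $\beta_1:=2\arg(z)$, $\beta_2:=0$, $\beta_3:=0$; if $z=0$ then $\beta_1:=2\arg(z')$, $\beta_2:=\pi$, $\beta_3:=0$; otherwise $\beta_1:=\arg(z)+\arg(z')$, $\beta_2:=2\arg\big(i+\big|\tfrac{z}{z'}\big|\big)$, $\beta_3:=\arg(z)-\arg(z')$. Then $D$ and $D'$ have the same interpretation (up to a non-zero scalar). Moreover, $D'$ has extended causal flow if $D$ has an extended causal flow $g$ such that $g(a)=\{b\}$ or $g(b)=\{a\}$.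
   Context: An MBQC-form ZX-diagram consists of a finite simple undirected graph $G=(V,E)$, inputs $I\subseteq V$, outputs $O\subseteq V$, and for each $v\in V\setminus O$ a measurement effect $e_v$ (a row vector up to non-zero scalar): $XY$-measured with angle $\alpha$ means $e_v=\langle0|+e^{i\alpha}\langle1|$; $YZ$-measured with angle $\alpha$ means $e_v=\langle+|+e^{i\alpha}\langle-|$; $XZ$-measured with angle $\alpha$ means $e_v=(\langle+|+e^{i\alpha}\langle-|)\circ\mathrm{diag}(1,i)$. Its interpretation, up to non-zero scalar, is the linear map $(\mathbb C^2)^{\otimes I}\to(\mathbb C^2)^{\otimes O}$, $|x\rangle\mapsto\sum_{y\in\{0,1\}^V,\,y|_I=x}(-1)^{|\{\{u,v\}\in E:\,y_u=y_v=1\}|}\big(\prod_{v\in V\setminus O}e_v|y_v\rangle\big)|y|_O\rangle$. Suppose all measurements are labelled $XY$ or $YZ$, by $\lambda:V\setminus O\to\{XY,YZ\}$. For $f:V\setminus O\to V\setminus I$ let $R_f=\{(u,v): v\neq u,\ v=f(u)\text{ or }v\in N_G(f(u))\}$. Then $f$ (where $f(v)$ is identified with $\{f(v)\}$) is an extended causal flow if the transitive closure of $R_f$ is a strict partial order and for all $v\in V\setminus O$: $\lambda(v)=XY\Rightarrow f(v)\in N_G(v)$, and $\lambda(v)=YZ\Rightarrow f(v)=v$. A diagram has extended causal flow if it has one for such a labelling; in the statement $a,b,x,y,t$ are labelled $XY$. *)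

theory Defs
  imports "HOL-Analysis.Analysis" "HOL-Library.Real_Mod" "HOL-Library.FuncSet"
begin

text \<open>Bits are booleans: False is the bit 0 and True is the bit 1. A row vector on one qubit is
  the function of its two components.\<close>

definition bra :: "bool \<Rightarrow> bool \<Rightarrow> complex" where
  "bra c = (\<lambda>b. if b = c then 1 else 0)"

definition bra_plus :: "bool \<Rightarrow> complex" where
  "bra_plus = (\<lambda>b. (bra False b + bra True b) / complex_of_real (sqrt 2))"

definition bra_minus :: "bool \<Rightarrow> complex" where
  "bra_minus = (\<lambda>b. (bra False b - bra True b) / complex_of_real (sqrt 2))"

datatype mplane = XY | YZ | XZ

fun measurement_effect :: "mplane \<Rightarrow> real \<Rightarrow> bool \<Rightarrow> complex" where
  "measurement_effect XY \<alpha> = (\<lambda>b. bra False b + exp (\<i> * \<alpha>) * bra True b)"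
| "measurement_effect YZ \<alpha> = (\<lambda>b. bra_plus b + exp (\<i> * \<alpha>) * bra_minus b)"
| "measurement_effect XZ \<alpha> =
     (\<lambda>b. (bra_plus b + exp (\<i> * \<alpha>) * bra_minus b) * (if b then \<i> else 1))"

text \<open>The field \<open>effect\<close> holds one representative of each effect; its values at outputs are
  irrelevant.\<close>

record 'v diagram =
  verts :: "'v set"
  edges :: "'v set set"
  inputs :: "'v set"
  outputs :: "'v set"
  effect :: "'v \<Rightarrow> bool \<Rightarrow> complex"

definition measured :: "'v diagram \<Rightarrow> 'v \<Rightarrow> mplane \<Rightarrow> real \<Rightarrow> bool" where
  "measured D v p \<alpha> \<longleftrightarrow> v \<in> verts D - outputs D \<and>
     (\<exists>c. c \<noteq> 0 \<and> (\<forall>b. effect D v b = c * measurement_effect p \<alpha> b))"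

definition mbqc_form :: "'v diagram \<Rightarrow> bool" where
  "mbqc_form D \<longleftrightarrow>
     finite (verts D) \<and>
     (\<forall>e\<in>edges D. e \<subseteq> verts D \<and> card e = 2) \<and>
     inputs D \<subseteq> verts D \<and> outputs D \<subseteq> verts D \<and>
     (\<forall>v\<in>verts D - outputs D. \<exists>p \<alpha>. measured D v p \<alpha>)"

definition nbrs :: "'v diagram \<Rightarrow> 'v \<Rightarrow> 'v set" where
  "nbrs D v = {u. {u, v} \<in> edges D}"

definition bitstrings :: "'v set \<Rightarrow> ('v \<Rightarrow> bool) set" where
  "bitstrings S = S \<rightarrow>\<^sub>E UNIV"

text \<open>A vector in the tensor product of one qubit per element of \<open>S\<close> is given by its coordinates
  in the computational basis, that is, by its values on \<open>bitstrings S\<close>.\<close>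

definition ket :: "('v \<Rightarrow> bool) \<Rightarrow> ('v \<Rightarrow> bool) \<Rightarrow> complex" where
  "ket x = (\<lambda>w. if w = x then 1 else 0)"

definition interp_basis :: "'v diagram \<Rightarrow> ('v \<Rightarrow> bool) \<Rightarrow> ('v \<Rightarrow> bool) \<Rightarrow> complex" where
  "interp_basis D x = (\<lambda>w.
     \<Sum>y\<in>{y \<in> bitstrings (verts D). restrict y (inputs D) = x}.
       (- 1) ^ card {e \<in> edges D. \<forall>u\<in>e. y u} *
       (\<Prod>v\<in>verts D - outputs D. effect D v (y v)) *
       ket (restrict y (outputs D)) w)"

definition interp :: "'v diagram \<Rightarrow> (('v \<Rightarrow> bool) \<Rightarrow> complex) \<Rightarrow> ('v \<Rightarrow> bool) \<Rightarrow> complex" where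
  "interp D \<psi> = (\<lambda>w. \<Sum>x\<in>bitstrings (inputs D). \<psi> x * interp_basis D x w)"

definition same_interp :: "'v diagram \<Rightarrow> 'v diagram \<Rightarrow> bool" where
  "same_interp D D' \<longleftrightarrow> inputs D = inputs D' \<and> outputs D = outputs D' \<and>
     (\<exists>c. c \<noteq> 0 \<and> (\<forall>\<psi> w. interp D' \<psi> w = c * interp D \<psi> w))"

text \<open>The same effect may be measured in two planes: for instance \<open>XY\<close> with angle \<open>pi / 2\<close> and
  \<open>YZ\<close> with angle \<open>- pi / 2\<close> agree up to a scalar. So a labelling is not determined by the
  effects.\<close>

definition labelling :: "'v diagram \<Rightarrow> ('v \<Rightarrow> mplane) \<Rightarrow> bool" where
  "labelling D lab \<longleftrightarrow>
     (\<forall>v\<in>verts D - outputs D. lab v \<in> {XY, YZ} \<and> (\<exists>\<alpha>. measured D v (lab v) \<alpha>))"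

definition flow_rel :: "'v diagram \<Rightarrow> ('v \<Rightarrow> 'v) \<Rightarrow> ('v \<times> 'v) set" where
  "flow_rel D f =
     {(u, v). u \<in> verts D - outputs D \<and> v \<noteq> u \<and> (v = f u \<or> v \<in> nbrs D (f u))}"

definition extended_causal_flow ::
  "'v diagram \<Rightarrow> ('v \<Rightarrow> mplane) \<Rightarrow> ('v \<Rightarrow> 'v) \<Rightarrow> bool" where
  "extended_causal_flow D lab f \<longleftrightarrow>
     labelling D lab \<and>
     f \<in> verts D - outputs D \<rightarrow> verts D - inputs D \<and>
     irrefl ((flow_rel D f)\<^sup>+) \<and> trans ((flow_rel D f)\<^sup>+) \<and>
     (\<forall>v\<in>verts D - outputs D.
        (lab v = XY \<longrightarrow> f v \<in> nbrs D v) \<and> (lab v = YZ \<longrightarrow> f v = v))"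

definition edge_to_path ::
  "'v diagram \<Rightarrow> 'v \<Rightarrow> 'v \<Rightarrow> 'v \<Rightarrow> 'v \<Rightarrow> 'v \<Rightarrow> real \<Rightarrow> real \<Rightarrow> real \<Rightarrow> 'v diagram" where
  "edge_to_path D a b x y t \<beta>\<^sub>1 \<beta>\<^sub>2 \<beta>\<^sub>3 =
     \<lparr> verts = verts D \<union> {x, y, t},
       edges = (edges D - {{a, b}}) \<union> {{a, x}, {x, y}, {y, t}, {t, b}},
       inputs = inputs D,
       outputs = outputs D,
       effect = (effect D)
         (a := measurement_effect XY 0,
          b := measurement_effect XY 0,
          x := measurement_effect XY \<beta>\<^sub>1,
          y := measurement_effect XY \<beta>\<^sub>2,
          t := measurement_effect XY \<beta>\<^sub>3) \<rparr>"

lemma mbqc_form_edge_to_path: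
  assumes "mbqc_form D" "a \<in> verts D - outputs D" "b \<in> verts D - outputs D"
    "distinct [x, y, t]" "{x, y, t} \<inter> verts D = {}"
  shows "mbqc_form (edge_to_path D a b x y t \<beta>\<^sub>1 \<beta>\<^sub>2 \<beta>\<^sub>3)"
proof -
  let ?D = "edge_to_path D a b x y t \<beta>\<^sub>1 \<beta>\<^sub>2 \<beta>\<^sub>3"
  have "\<exists>p \<alpha>. measured ?D v p \<alpha>" if v: "v \<in> verts ?D - outputs ?D" for v
  proof (cases "v \<in> {a, b, x, y, t}")
    case True
    then have "effect ?D v \<in> range (measurement_effect XY)"
      unfolding edge_to_path_def by (auto simp del: measurement_effect.simps)
    then obtain \<alpha> where "effect ?D v = measurement_effect XY \<alpha>"
      by blast
    then have "measured ?D v XY \<alpha>"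
      unfolding measured_def using v by (auto intro!: exI[of _ 1])
    then show ?thesis by blast
  next
    case False
    then have "v \<in> verts D - outputs D" "effect ?D v = effect D v"
      using v unfolding edge_to_path_def by auto
    then show ?thesis
      using assms(1) v unfolding mbqc_form_def measured_def by auto
  qed
  then show ?thesis
    using assms unfolding mbqc_form_def edge_to_path_def
    by (auto simp: card_insert_if)
qed

end

theory Submission
  imports Defs
begin

text \<open>Write \<open>A\<close>, \<open>B\<close>, \<open>C\<close> for \<open>cis\<close> of the three new angles and \<open>P\<close>, \<open>Q\<close> for \<open>cis\<close> of the two old ones.
  Summing out the bits of \<open>x\<close>, \<open>y\<close>, \<open>t\<close> leaves a function of the bits of \<open>a\<close> and \<open>b\<close> with values
  \<open>(1 + B)(1 + AC) \<plusminus> (1 - B)(A + C)\<close> and \<open>(1 + B)(1 - AC) \<plusminus> (1 - B)(C - A)\<close>. It is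
  proportional to \<open>1, P, Q, - PQ\<close> if and only if \<open>1 + B\<close>, \<open>(1 + B) AC\<close>, \<open>(1 - B) A\<close>, \<open>(1 - B) C\<close> are
  proportional to \<open>\<i> cnj z\<close>, \<open>\<i> z\<close>, \<open>z'\<close>, \<open>cnj z'\<close>, and the given angles are the solution:
  \<open>AC = z / cnj z\<close>, \<open>A / C = z' / cnj z'\<close> and \<open>(1 + B) / (1 - B) = \<i> \<bar>z / z'\<bar>\<close>.
  For the flow, if \<open>g a = b\<close> then \<open>a\<close>, \<open>x\<close>, \<open>y\<close>, \<open>t\<close> are corrected by \<open>x\<close>, \<open>y\<close>, \<open>t\<close>, \<open>b\<close>; the case
  \<open>g b = a\<close> is the same read backwards along the path.\<close>

section \<open>Phases of the new angles\<close>

text \<open>\<open>cis (Arg z)\<close> is \<open>sgn z\<close>, whose square is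
  \<open>z * z / (z * cnj z)\<close>. This makes a doubled argument rational in \<open>z\<close> and
  \<open>cnj z\<close>.\<close>

lemma cis_2_Arg:
  assumes "z \<noteq> 0"
  shows "cis (2 * Arg z) = z / cnj z"
proof -
  have "cis (2 * Arg z) = (sgn z)\<^sup>2"
    by (simp add: cis_Arg[OF assms, symmetric] Complex.DeMoivre)
  also have "\<dots> = z\<^sup>2 / (z * cnj z)"
    by (simp add: sgn_eq power_divide flip: complex_norm_square)
  also have "\<dots> = z / cnj z"
    using assms by (simp add: power2_eq_square)
  finally show ?thesis .
qed

text \<open>This is \<open>(1 + cis \<beta>) / (1 - cis \<beta>) = \<i> cot (\<beta> / 2)\<close> with \<open>cot (\<beta> / 2) = r\<close>.\<close>

lemma cis_2_Arg_i_plus: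
  fixes r :: real
  defines "B \<equiv> cis (2 * Arg (\<i> + r))"
  shows "1 + B = \<i> * r * (1 - B)" "B \<noteq> 1"
proof -
  have nz: "\<i> + complex_of_real r \<noteq> 0" "complex_of_real r - \<i> \<noteq> 0"
    by (simp_all add: complex_eq_iff)
  have "B = (r + \<i>) / (r - \<i>)"
    unfolding B_def using cis_2_Arg[OF nz(1)] by (simp add: add.commute)
  then have B: "B * (r - \<i>) = r + \<i>"
    using nz(2) by simp
  then show "B \<noteq> 1"
    by (auto simp: complex_eq_iff)
  have "\<i> * \<i> = -1" by simp
  with B show "1 + B = \<i> * r * (1 - B)"
    by algebra
qed

text \<open>Since \<open>A * C = z / cnj z\<close> and \<open>A / C = z' / cnj z'\<close> in the
  generic case, each pair of equations reduces to one, and the choice of \<open>B\<close> gives both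
  pairs the same factor \<open>k\<close>. Free of quotients, the system also covers
  \<open>z' = 0\<close> and \<open>z = 0\<close>, where \<open>B\<close> is \<open>1\<close> or
  \<open>- 1\<close> and one pair reads \<open>0 = 0\<close>.\<close>

lemma euler_angles:
  fixes z z' :: complex
  assumes "z \<noteq> 0 \<or> z' \<noteq> 0"
  defines "A \<equiv> cis (if z' = 0 then 2 * Arg z else if z = 0 then 2 * Arg z' else Arg z + Arg z')"
    and "B \<equiv> cis (if z' = 0 then 0 else if z = 0 then pi else 2 * Arg (\<i> + cmod (z / z')))"
    and "C \<equiv> cis (if z' = 0 then 0 else if z = 0 then 0 else Arg z - Arg z')"
  obtains k where "k \<noteq> 0"
    "1 + B = k * \<i> * cnj z" "(1 + B) * (A * C) = k * \<i> * z"
    "(1 - B) * A = k * z'" "(1 - B) * C = k * cnj z'"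
proof -
  consider "z' = 0" "z \<noteq> 0" | "z = 0" "z' \<noteq> 0" | "z \<noteq> 0" "z' \<noteq> 0"
    using assms by blast
  then show thesis
  proof cases
    case 1
    then have "A = z / cnj z" "B = 1" "C = 1"
      by (simp_all add: A_def B_def C_def cis_2_Arg)
    \<comment> \<open>Here \<open>1 + B = 2\<close>, so the first equation dictates
      \<open>k\<close>.\<close>
    with 1 show thesis
      by (intro that[of "2 / (\<i> * cnj z)"]) auto
  next
    case 2
    then have "A = z' / cnj z'" "B = - 1" "C = 1"
      by (simp_all add: A_def B_def C_def cis_2_Arg)
    \<comment> \<open>Here \<open>(1 - B) * C = 2\<close>, so the last equation dictates
      \<open>k\<close>.\<close>
    with 2 show thesis
      by (intro that[of "2 / cnj z'"]) auto
  next
    case 3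
    define r where "r = cmod (z / z')"
    have B: "1 + B = \<i> * r * (1 - B)" "B \<noteq> 1"
      using cis_2_Arg_i_plus[of r] 3 by (simp_all add: B_def r_def)
    have "A = cis (Arg z) * cis (Arg z')" "C = cis (Arg z) / cis (Arg z')"
      using 3 by (simp_all add: A_def C_def cis_mult cis_divide)
    then have AC: "A = sgn z * sgn z'" "C = sgn z / sgn z'"
      using 3 by (simp_all add: cis_Arg)
    \<comment> \<open>The moduli enter only as nonzero numbers with known squares, which keeps the
      remaining identities algebraic.\<close>
    obtain \<rho> where \<rho>: "\<rho> = complex_of_real (cmod z)" "\<rho> \<noteq> 0" "\<rho> * \<rho> = z * cnj z"
      using 3 complex_norm_square[of z] by (simp add: power2_eq_square)
    obtain \<rho>' where \<rho>': "\<rho>' = complex_of_real (cmod z')" "\<rho>' \<noteq> 0" "\<rho>' * \<rho>' = z' * cnj z'"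
      using 3 complex_norm_square[of z'] by (simp add: power2_eq_square)
    have r: "complex_of_real r = \<rho> / \<rho>'"
      by (simp add: r_def \<rho> \<rho>' norm_divide)
    have A: "A = z * z' / (\<rho> * \<rho>')" and C: "C = z * \<rho>' / (\<rho> * z')"
      using AC by (simp_all add: sgn_eq \<rho> \<rho>')
    have AC': "A * C = z / cnj z"
      using \<rho>(2,3) \<rho>'(2) 3 by (simp add: A C field_simps)
    \<comment> \<open>The third equation, with \<open>A = z * z' / (\<rho> * \<rho>')\<close>,
      forces this value.\<close>
    define k where "k = (1 - B) * z / (\<rho> * \<rho>')"
    have "k * \<i> * cnj z = \<i> * (\<rho> * \<rho>) / (\<rho> * \<rho>') * (1 - B)"
      by (simp add: k_def \<rho>(3))
    with \<rho>(2) have 1: "1 + B = k * \<i> * cnj z"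
      by (simp add: B(1) r)
    show thesis
    proof (rule that)
      show "k \<noteq> 0" using B 3 \<rho> \<rho>' by (simp add: k_def)
      show "1 + B = k * \<i> * cnj z" by fact
      show "(1 + B) * (A * C) = k * \<i> * z"
        unfolding 1 AC' using 3 by simp
      show "(1 - B) * A = k * z'" by (simp add: A k_def)
      show "(1 - B) * C = k * cnj z'"
      proof -
        have "cnj z' = \<rho>' * \<rho>' / z'" using \<rho>'(3) 3 by simp
        then show ?thesis using \<rho>'(2) by (simp add: C k_def)
      qed
    qed
  qed
qed

section \<open>The kernel of the path and the kernel of the edge\<close>

abbreviation sgn_edge :: "bool \<Rightarrow> bool \<Rightarrow> complex" where
  "sgn_edge p q \<equiv> (if p \<and> q then - 1 else 1)"

lemma measurement_effect_XY:
  "measurement_effect XY \<alpha> p = (if p then cis \<alpha> else 1)"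
  by (simp add: bra_def cis_conv_exp)

text \<open>The right-hand sides are the four signed sums (the Walsh-Hadamard transform) of the edge
  kernel \<open>1\<close>, \<open>P\<close>, \<open>Q\<close>, \<open>- P * Q\<close>. The factor
  \<open>w\<close> clears the half angles: with half-sum \<open>s\<close> and half-difference
  \<open>d\<close>, the phases \<open>P\<close> and \<open>Q\<close> are \<open>cis s\<close> times
  \<open>cis d\<close> and times its conjugate.\<close>

lemma half_angle_coordinates:
  fixes \<alpha>\<^sub>1 \<alpha>\<^sub>2 :: real
  defines "z \<equiv> - sin ((\<alpha>\<^sub>1 + \<alpha>\<^sub>2) / 2) + \<i> * cos ((\<alpha>\<^sub>1 - \<alpha>\<^sub>2) / 2)"
    and "z' \<equiv> cos ((\<alpha>\<^sub>1 + \<alpha>\<^sub>2) / 2) - \<i> * sin ((\<alpha>\<^sub>1 - \<alpha>\<^sub>2) / 2)"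
  defines "w \<equiv> 2 * cis ((\<alpha>\<^sub>1 + \<alpha>\<^sub>2) / 2)"
  defines "P \<equiv> cis \<alpha>\<^sub>1" and "Q \<equiv> cis \<alpha>\<^sub>2"
  shows "w * (\<i> * cnj z) = P + Q + 1 - P * Q" "w * (\<i> * z) = 1 - P * Q - P - Q"
    "w * z' = 1 + P * Q - P + Q" "w * cnj z' = 1 + P * Q + P - Q"
proof -
  define s d where "s = (\<alpha>\<^sub>1 + \<alpha>\<^sub>2) / 2" and "d = (\<alpha>\<^sub>1 - \<alpha>\<^sub>2) / 2"
  have "\<alpha>\<^sub>1 = s + d" "\<alpha>\<^sub>2 = s - d"
    by (simp_all add: s_def d_def field_simps)
  then have PQ: "P = cis s * cis d" "Q = cis s * cnj (cis d)"
    by (simp_all add: P_def Q_def cis_mult cis_cnj)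
  have ds: "cis d * cnj (cis d) = 1" "cis s * cnj (cis s) = 1"
    by (simp_all add: cis_cnj cis_mult)
  have z: "\<i> * z = - (cis s - cnj (cis s)) / 2 - (cis d + cnj (cis d)) / 2"
    "\<i> * cnj z = - (cis s - cnj (cis s)) / 2 + (cis d + cnj (cis d)) / 2"
    "z' = (cis s + cnj (cis s)) / 2 - (cis d - cnj (cis d)) / 2"
    "cnj z' = (cis s + cnj (cis s)) / 2 + (cis d - cnj (cis d)) / 2"
    by (simp_all add: z_def z'_def s_def d_def complex_eq_iff)
  have w: "w = 2 * cis s" by (simp add: w_def s_def)
  show "w * (\<i> * cnj z) = P + Q + 1 - P * Q" "w * (\<i> * z) = 1 - P * Q - P - Q"
    "w * z' = 1 + P * Q - P + Q" "w * cnj z' = 1 + P * Q + P - Q"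
    \<comment> \<open>\<open>cnj z'\<close> is replaced before \<open>z'\<close>, which occurs in
      it.\<close>
    unfolding z(4) unfolding z(1-3) w PQ using ds by algebra+
qed

text \<open>The rewrite is local: for fixed bits \<open>p\<close> of \<open>a\<close> and
  \<open>q\<close> of \<open>b\<close>, the three inner vertices sum to what the edge and the two
  old effects contributed. Up to the factor 4, the transform of the path kernel is
  \<open>1 + B\<close>, \<open>(1 + B) * (A * C)\<close>, \<open>(1 - B) * A\<close>,
  \<open>(1 - B) * C\<close>, so it suffices to compare transforms.\<close>

lemma path_kernel_eq_edge_kernel:
  fixes \<alpha>\<^sub>1 \<alpha>\<^sub>2 :: real and z z' :: complex
  assumes "z = - sin ((\<alpha>\<^sub>1 + \<alpha>\<^sub>2) / 2) + \<i> * cos ((\<alpha>\<^sub>1 - \<alpha>\<^sub>2) / 2)"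
    and "z' = cos ((\<alpha>\<^sub>1 + \<alpha>\<^sub>2) / 2) - \<i> * sin ((\<alpha>\<^sub>1 - \<alpha>\<^sub>2) / 2)"
    and "\<beta>\<^sub>1 = (if z' = 0 then 2 * Arg z else if z = 0 then 2 * Arg z' else Arg z + Arg z')
           rmod (2 * pi)"
    and "\<beta>\<^sub>2 = (if z' = 0 then 0 else if z = 0 then pi else 2 * Arg (\<i> + cmod (z / z')))
           rmod (2 * pi)"
    and "\<beta>\<^sub>3 = (if z' = 0 then 0 else if z = 0 then 0 else Arg z - Arg z')
           rmod (2 * pi)"
  obtains c where "c \<noteq> 0"
    "\<And>p q. (\<Sum>i\<in>UNIV. \<Sum>j\<in>UNIV. \<Sum>l\<in>UNIV.
        sgn_edge p i * sgn_edge i j * sgn_edge j l * sgn_edge l q *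
        (measurement_effect XY \<beta>\<^sub>1 i * measurement_effect XY \<beta>\<^sub>2 j * measurement_effect XY \<beta>\<^sub>3 l)) =
      c * (sgn_edge p q * (measurement_effect XY \<alpha>\<^sub>1 p * measurement_effect XY \<alpha>\<^sub>2 q))"
proof -
  define A B C where "A = cis \<beta>\<^sub>1" and "B = cis \<beta>\<^sub>2" and "C = cis \<beta>\<^sub>3"
  define P Q w where "P = cis \<alpha>\<^sub>1" and "Q = cis \<alpha>\<^sub>2" and "w = 2 * cis ((\<alpha>\<^sub>1 + \<alpha>\<^sub>2) / 2)"
  have cis_rmod: "cis (\<beta> rmod (2 * pi)) = cis \<beta>" for \<beta>
    by (simp add: cis_eq_iff)
  note coords = half_angle_coordinates[of \<alpha>\<^sub>1 \<alpha>\<^sub>2, folded assms(1,2), folded P_def Q_def w_def]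
  have "w \<noteq> 0" by (simp add: w_def)
  \<comment> \<open>Otherwise the first two sums give \<open>P * Q = 1\<close> and
    \<open>P + Q = 0\<close>; the third then gives \<open>P = 1\<close>, \<open>Q = - 1\<close>,
    contradicting \<open>P * Q = 1\<close>.\<close>
  have "z \<noteq> 0 \<or> z' \<noteq> 0"
  proof (rule ccontr)
    assume "\<not> ?thesis"
    then have "P + Q + 1 - P * Q = 0" "1 - P * Q - P - Q = 0"
      "1 + P * Q - P + Q = 0" using coords by simp_all
    then show False by algebra
  qed
  from euler_angles[OF this] obtain k where k: "k \<noteq> 0"
    "1 + B = k * \<i> * cnj z" "(1 + B) * (A * C) = k * \<i> * z"
    "(1 - B) * A = k * z'" "(1 - B) * C = k * cnj z'"
    unfolding A_def B_def C_def assms(3-5) cis_rmod by metis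
  define c where "c = k / w"
  have "k = c * w" using \<open>w \<noteq> 0\<close> by (simp add: c_def)
  with k coords have eqs:
    "1 + B = c * (P + Q + 1 - P * Q)" "(1 + B) * (A * C) = c * (1 - P * Q - P - Q)"
    "(1 - B) * A = c * (1 + P * Q - P + Q)" "(1 - B) * C = c * (1 + P * Q + P - Q)"
    by (metis mult.assoc)+
  \<comment> \<open>Inverting the transform yields the four kernel values; this is the origin of the
    factor 4.\<close>
  have K: "(1 + B) * (1 + A * C) + (1 - B) * (A + C) = 4 * c"
    "(1 + B) * (1 - A * C) + (1 - B) * (C - A) = 4 * c * P"
    "(1 + B) * (1 - A * C) + (1 - B) * (A - C) = 4 * c * Q"
    "(1 + B) * (1 + A * C) - (1 - B) * (A + C) = - 4 * c * (P * Q)"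
    using eqs by algebra+
  show thesis
  proof (rule that)
    show "4 * c \<noteq> 0" using k(1) \<open>w \<noteq> 0\<close> by (simp add: c_def)
  next
    fix p q
    show "(\<Sum>i\<in>UNIV. \<Sum>j\<in>UNIV. \<Sum>l\<in>UNIV.
        sgn_edge p i * sgn_edge i j * sgn_edge j l * sgn_edge l q *
        (measurement_effect XY \<beta>\<^sub>1 i * measurement_effect XY \<beta>\<^sub>2 j * measurement_effect XY \<beta>\<^sub>3 l)) =
      4 * c * (sgn_edge p q * (measurement_effect XY \<alpha>\<^sub>1 p * measurement_effect XY \<alpha>\<^sub>2 q))"
      using K unfolding measurement_effect_XY A_def[symmetric] B_def[symmetric] C_def[symmetric]
        P_def[symmetric] Q_def[symmetric]
      by (cases p; cases q) (simp_all add: UNIV_bool algebra_simps)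
  qed
qed

section \<open>Interpretations as sums over bit strings\<close>

text \<open>Used once per new vertex, to sum out its bit while the bits of the old vertices stay
  fixed.\<close>

lemma sum_bitstrings_insert:
  assumes "v \<notin> S"
  shows "(\<Sum>y\<in>bitstrings (insert v S). F y) = (\<Sum>y\<in>bitstrings S. \<Sum>i\<in>UNIV. F (y(v := i)))"
proof -
  have "(\<Sum>y\<in>bitstrings (insert v S). F y)
      = (\<Sum>(i, y)\<in>UNIV \<times> bitstrings S. F (y(v := i)))"
    unfolding bitstrings_def PiE_insert_eq
    by (subst sum.reindex[OF inj_combinator[OF assms]]) (simp add: case_prod_unfold)
  also have "\<dots> = (\<Sum>y\<in>bitstrings S. \<Sum>i\<in>UNIV. F (y(v := i)))"
    by (subst sum.swap) (simp add: sum.cartesian_product)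
  finally show ?thesis .
qed

lemma finite_bitstrings: "finite S \<Longrightarrow> finite (bitstrings S)"
  by (simp add: bitstrings_def finite_PiE)

text \<open>One local factor per edge in place of a global count, so that a single edge can be
  exchanged inside a product.\<close>

definition edge_sign :: "('v \<Rightarrow> bool) \<Rightarrow> 'v set \<Rightarrow> complex" where
  "edge_sign y e = (if \<forall>u\<in>e. y u then - 1 else 1)"

lemma edge_sign_doubleton: "edge_sign y {u, v} = sgn_edge (y u) (y v)"
  by (simp add: edge_sign_def)

lemma prod_edge_sign:
  assumes "finite E"
  shows "(\<Prod>e\<in>E. edge_sign y e) = (- 1) ^ card {e \<in> E. \<forall>u\<in>e. y u}"
  using assms unfolding edge_sign_def by (simp flip: prod.inter_filter)

lemma mbqc_formD:
  assumes "mbqc_form D"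
  shows "finite (verts D)" "finite (edges D)" "inputs D \<subseteq> verts D" "outputs D \<subseteq> verts D"
    "{u, v} \<in> edges D \<Longrightarrow> u \<in> verts D \<and> v \<in> verts D \<and> u \<noteq> v"
proof -
  show "finite (verts D)" "finite (edges D)" "inputs D \<subseteq> verts D" "outputs D \<subseteq> verts D"
    using assms finite_subset[of "edges D" "Pow (verts D)"] by (auto simp: mbqc_form_def)
  assume "{u, v} \<in> edges D"
  then have "{u, v} \<subseteq> verts D" "card {u, v} = 2"
    using assms by (auto simp: mbqc_form_def)
  then show "u \<in> verts D \<and> v \<in> verts D \<and> u \<noteq> v"
    by (cases "u = v") auto
qed

text \<open>The input constraint becomes a 0/1 factor, so that the sum runs over all bit strings and
  can be split vertex by vertex.\<close>

lemma interp_basis_eq: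
  assumes "mbqc_form D"
  shows "interp_basis D X w = (\<Sum>y\<in>bitstrings (verts D).
    of_bool (restrict y (inputs D) = X) * ket (restrict y (outputs D)) w *
    ((\<Prod>e\<in>edges D. edge_sign y e) * (\<Prod>v\<in>verts D - outputs D. effect D v (y v))))"
  unfolding interp_basis_def
  by (subst sum.inter_filter[OF finite_bitstrings[OF mbqc_formD(1)[OF assms]]])
    (auto intro!: sum.cong simp: prod_edge_sign[OF mbqc_formD(2)[OF assms]])

lemma edge_to_path_fields [simp]:
  "verts (edge_to_path D a b x y t \<beta>\<^sub>1 \<beta>\<^sub>2 \<beta>\<^sub>3) = insert t (insert y (insert x (verts D)))"
  "edges (edge_to_path D a b x y t \<beta>\<^sub>1 \<beta>\<^sub>2 \<beta>\<^sub>3) =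
     (edges D - {{a, b}}) \<union> {{a, x}, {x, y}, {y, t}, {t, b}}"
  "inputs (edge_to_path D a b x y t \<beta>\<^sub>1 \<beta>\<^sub>2 \<beta>\<^sub>3) = inputs D"
  "outputs (edge_to_path D a b x y t \<beta>\<^sub>1 \<beta>\<^sub>2 \<beta>\<^sub>3) = outputs D"
  "effect (edge_to_path D a b x y t \<beta>\<^sub>1 \<beta>\<^sub>2 \<beta>\<^sub>3) = (effect D)
     (a := measurement_effect XY 0, b := measurement_effect XY 0, x := measurement_effect XY \<beta>\<^sub>1,
      y := measurement_effect XY \<beta>\<^sub>2, t := measurement_effect XY \<beta>\<^sub>3)"
  by (auto simp: edge_to_path_def)

text \<open>For fixed bits of the old vertices both summands share every factor away from the edge
  and from the effects of \<open>a\<close> and \<open>b\<close>; what differs is settled by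
  \<open>kernel\<close>. The scalars \<open>ca\<close> and \<open>cb\<close> appear because the
  effects of \<open>D\<close> are fixed only up to a factor, while the new effects of
  \<open>a\<close> and \<open>b\<close> are normalised.\<close>

lemma interp_basis_edge_to_path:
  fixes D :: "'v diagram"
  assumes D: "mbqc_form D" and ab: "{a, b} \<in> edges D"
    and a: "measured D a XY \<alpha>\<^sub>1" and b: "measured D b XY \<alpha>\<^sub>2"
    and xyt: "distinct [x, y, t]" "{x, y, t} \<inter> verts D = {}"
    and kernel: "\<And>p q. (\<Sum>i\<in>UNIV. \<Sum>j\<in>UNIV. \<Sum>l\<in>UNIV.
        sgn_edge p i * sgn_edge i j * sgn_edge j l * sgn_edge l q *
        (measurement_effect XY \<beta>\<^sub>1 i * measurement_effect XY \<beta>\<^sub>2 j * measurement_effect XY \<beta>\<^sub>3 l)) =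
      c * (sgn_edge p q * (measurement_effect XY \<alpha>\<^sub>1 p * measurement_effect XY \<alpha>\<^sub>2 q))"
    and ca: "ca \<noteq> 0" "\<And>p. effect D a p = ca * measurement_effect XY \<alpha>\<^sub>1 p"
    and cb: "cb \<noteq> 0" "\<And>p. effect D b p = cb * measurement_effect XY \<alpha>\<^sub>2 p"
  shows "interp_basis (edge_to_path D a b x y t \<beta>\<^sub>1 \<beta>\<^sub>2 \<beta>\<^sub>3) X w = c / (ca * cb) * interp_basis D X w"
proof -
  let ?D = "edge_to_path D a b x y t \<beta>\<^sub>1 \<beta>\<^sub>2 \<beta>\<^sub>3"
  note fin = mbqc_formD(1,2)[OF D] and io = mbqc_formD(3,4)[OF D] and edge = mbqc_formD(5)[OF D]
  have abV: "a \<in> verts D - outputs D" "b \<in> verts D - outputs D" "a \<noteq> b"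
    using a b edge[OF ab] by (auto simp: measured_def)
  have D': "mbqc_form ?D"
    using mbqc_form_edge_to_path[OF D abV(1,2) xyt] .
  \<comment> \<open>\<open>M\<close>, \<open>N\<close> and \<open>R\<close> collect the shared
    factors: the other edges, the other effects, and the inputs and outputs. All of them depend on
    old bits only.\<close>
  define M N where "M y0 = (\<Prod>e\<in>edges D - {{a, b}}. edge_sign y0 e)"
    and "N y0 = (\<Prod>v\<in>verts D - outputs D - {a, b}. effect D v (y0 v))" for y0
  define R where "R y0 = of_bool (restrict y0 (inputs D) = X) * ket (restrict y0 (outputs D)) w"
    for y0 :: "'v \<Rightarrow> bool"
  define F F' where "F = (\<lambda>y0. R y0 *
      ((\<Prod>e\<in>edges D. edge_sign y0 e) * (\<Prod>v\<in>verts D - outputs D. effect D v (y0 v))))"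
    and "F' = (\<lambda>y0. R y0 *
      ((\<Prod>e\<in>edges ?D. edge_sign y0 e) * (\<Prod>v\<in>verts ?D - outputs D. effect ?D v (y0 v))))"
  have F: "F y0 = R y0 * M y0 * N y0 * (ca * cb) *
    (sgn_edge (y0 a) (y0 b) * (measurement_effect XY \<alpha>\<^sub>1 (y0 a) * measurement_effect XY \<alpha>\<^sub>2 (y0 b)))" for y0
  proof -
    have "(\<Prod>e\<in>edges D. edge_sign y0 e) = edge_sign y0 {a, b} * M y0"
      unfolding M_def using fin(2) ab by (rule prod.remove)
    moreover have "verts D - outputs D = insert a (insert b (verts D - outputs D - {a, b}))"
      using abV by blast
    then have "(\<Prod>v\<in>verts D - outputs D. effect D v (y0 v))
        = (\<Prod>v\<in>insert a (insert b (verts D - outputs D - {a, b})). effect D v (y0 v))"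
      by simp
    then have "(\<Prod>v\<in>verts D - outputs D. effect D v (y0 v))
        = effect D a (y0 a) * (effect D b (y0 b) * N y0)"
      using fin(1) abV(3) by (simp add: N_def)
    ultimately show ?thesis
      by (simp add: F_def edge_sign_doubleton ca cb del: measurement_effect.simps)
  qed
  \<comment> \<open>The effects of \<open>a\<close> and \<open>b\<close> leave no trace here, since
    an \<open>XY\<close> effect of angle 0 has both components equal to 1.\<close>
  have F': "F' (y0(x := i, y := j, t := l)) = R y0 * M y0 * N y0 *
      (sgn_edge (y0 a) i * sgn_edge i j * sgn_edge j l * sgn_edge l (y0 b) *
       (measurement_effect XY \<beta>\<^sub>1 i * measurement_effect XY \<beta>\<^sub>2 j * measurement_effect XY \<beta>\<^sub>3 l))"
    for y0 i j l
  proof -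
    let ?y = "y0(x := i, y := j, t := l)"
    have xyt': "x \<noteq> y" "x \<noteq> t" "y \<noteq> t" "x \<notin> verts D" "y \<notin> verts D" "t \<notin> verts D"
      using xyt by auto
    have new: "u \<noteq> x" "u \<noteq> y" "u \<noteq> t" if "u \<in> verts D" for u
      using that xyt' by auto
    have R: "R ?y = R y0"
    proof -
      have "restrict ?y S = restrict y0 S" if "S \<subseteq> verts D" for S
        using that new by (intro restrict_ext) auto
      then show ?thesis using io by (simp add: R_def)
    qed
    have "(\<Prod>e\<in>edges D - {{a, b}}. edge_sign ?y e) = M y0"
      unfolding M_def edge_sign_def
    proof (rule prod.cong[OF refl])
      fix e assume "e \<in> edges D - {{a, b}}"
      then have "e \<subseteq> verts D" using D by (auto simp: mbqc_form_def)
      then have "(\<forall>u\<in>e. ?y u) \<longleftrightarrow> (\<forall>u\<in>e. y0 u)" using new by (metis fun_upd_other subsetD)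
      then show "(if \<forall>u\<in>e. ?y u then - 1 else 1 :: complex) = (if \<forall>u\<in>e. y0 u then - 1 else 1)"
        by simp
    qed
    moreover have "(edges D - {{a, b}}) \<inter> {{a, x}, {x, y}, {y, t}, {t, b}} = {}"
      using edge xyt' by blast
    moreover have "(\<Prod>e\<in>{{a, x}, {x, y}, {y, t}, {t, b}}. edge_sign ?y e)
        = sgn_edge (y0 a) i * sgn_edge i j * sgn_edge j l * sgn_edge l (y0 b)"
    proof -
      \<comment> \<open>If two of these edges coincided, the product over the set would lose a
        sign.\<close>
      have "distinct [{a, x}, {x, y}, {y, t}, {t, b}]"
        using xyt' abV new[of a] new[of b] by (auto simp: doubleton_eq_iff)
      then show ?thesis
        using xyt' abV new[of a] new[of b] by (simp add: edge_sign_doubleton)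
    qed
    ultimately have edges: "(\<Prod>e\<in>edges ?D. edge_sign ?y e)
        = M y0 * (sgn_edge (y0 a) i * sgn_edge i j * sgn_edge j l * sgn_edge l (y0 b))"
      using fin(2) by (simp add: prod.union_disjoint del: Un_insert_right)
    have V: "verts ?D - outputs D = insert x (insert y (insert t (insert a (insert b
        (verts D - outputs D - {a, b})))))"
      using abV io xyt' by auto
    have "(\<Prod>v\<in>verts D - outputs D - {a, b}. effect ?D v (?y v)) = N y0"
      unfolding N_def using new by (intro prod.cong) auto
    then have effects: "(\<Prod>v\<in>verts ?D - outputs D. effect ?D v (?y v))
        = measurement_effect XY \<beta>\<^sub>1 i * measurement_effect XY \<beta>\<^sub>2 j * measurement_effect XY \<beta>\<^sub>3 l * N y0"
      unfolding V using fin(1) xyt' abV new[of a] new[of b]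
      by (simp add: measurement_effect_XY del: measurement_effect.simps)
    show ?thesis
      unfolding F'_def R edges effects by (simp del: measurement_effect.simps)
  qed
  have "interp_basis ?D X w = (\<Sum>y0\<in>bitstrings (verts ?D). F' y0)"
    unfolding interp_basis_eq[OF D'] F'_def R_def by simp
  also have "\<dots> = (\<Sum>y0\<in>bitstrings (verts D).
      \<Sum>i\<in>UNIV. \<Sum>j\<in>UNIV. \<Sum>l\<in>UNIV. F' (y0(x := i, y := j, t := l)))"
  proof -
    have "t \<notin> insert y (insert x (verts D))" "y \<notin> insert x (verts D)" "x \<notin> verts D"
      using xyt by auto
    note insert_new = this[THEN sum_bitstrings_insert]
    show ?thesis
      unfolding edge_to_path_fields
      by (subst insert_new(1), subst insert_new(2), subst insert_new(3)) (rule refl)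
  qed
  also have "\<dots> = (\<Sum>y0\<in>bitstrings (verts D). c / (ca * cb) * F y0)"
    unfolding F' sum_distrib_left[symmetric] kernel unfolding F sum_distrib_left using ca(1) cb(1)
    by (intro sum.cong refl) (simp del: measurement_effect.simps)
  also have "\<dots> = c / (ca * cb) * interp_basis D X w"
    unfolding interp_basis_eq[OF D] F_def R_def by (simp add: sum_distrib_left)
  finally show ?thesis .
qed

section \<open>Transfer of the extended causal flow\<close>

text \<open>Reading the path from \<open>b\<close> to \<open>a\<close> reverses the angles along
  with the vertices. This reduces the case \<open>g b = a\<close> to \<open>g a = b\<close>.\<close>

lemma edge_to_path_commute:
  assumes "a \<noteq> b" "distinct [x, y, t]" "a \<notin> {x, y, t}" "b \<notin> {x, y, t}"
  shows "edge_to_path D a b x y t \<beta>\<^sub>1 \<beta>\<^sub>2 \<beta>\<^sub>3 = edge_to_path D b a t y x \<beta>\<^sub>3 \<beta>\<^sub>2 \<beta>\<^sub>1"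
proof -
  have "{{a, x}, {x, y}, {y, t}, {t, b}} = {{b, t}, {t, y}, {y, x}, {x, a}}"
    by (simp add: insert_commute)
  then show ?thesis
    using assms unfolding edge_to_path_def
    by (auto simp: fun_upd_def insert_commute simp del: measurement_effect.simps)
qed

text \<open>The new vertices inherit the position of \<open>a\<close> and are ordered along the path behind it.\<close>

lemma extended_causal_flow_edge_to_path:
  fixes D :: "'v diagram"
  assumes D: "mbqc_form D" and ab: "{a, b} \<in> edges D"
    and a: "a \<in> verts D - outputs D" and b: "b \<in> verts D - outputs D"
    and xyt: "distinct [x, y, t]" "{x, y, t} \<inter> verts D = {}"
    and flow: "extended_causal_flow D lab g" and lab: "lab a = XY" "lab b = XY" and g: "g a = b"
  shows "extended_causal_flow (edge_to_path D a b x y t \<beta>\<^sub>1 \<beta>\<^sub>2 \<beta>\<^sub>3)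
    (lab(x := XY, y := XY, t := XY)) (g(a := x, x := y, y := t, t := b))"
proof -
  let ?D = "edge_to_path D a b x y t \<beta>\<^sub>1 \<beta>\<^sub>2 \<beta>\<^sub>3"
  let ?lab = "lab(x := XY, y := XY, t := XY)"
  let ?f = "g(a := x, x := y, y := t, t := b)"
  note io = mbqc_formD(3,4)[OF D] and edge = mbqc_formD(5)[OF D]
  define R where "R = (flow_rel D g)\<^sup>+"
  have step: "(u, v) \<in> R" if "u \<in> verts D - outputs D" "v \<noteq> u" "v = g u \<or> {v, g u} \<in> edges D" for u v
    using that by (auto simp: R_def flow_rel_def nbrs_def)
  have R: "trans R" "irrefl R" and labelling: "labelling D lab"
    and gV: "\<And>v. v \<in> verts D - outputs D \<Longrightarrow> g v \<in> verts D - inputs D"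
    and XY: "\<And>v. v \<in> verts D - outputs D \<Longrightarrow> lab v = XY \<Longrightarrow> {g v, v} \<in> edges D"
    and YZ: "\<And>v. v \<in> verts D - outputs D \<Longrightarrow> lab v = YZ \<Longrightarrow> g v = v"
    and lab_range: "\<And>v. v \<in> verts D - outputs D \<Longrightarrow> lab v \<in> {XY, YZ}"
    using flow by (auto simp: R_def extended_causal_flow_def labelling_def nbrs_def)
  have xyt': "x \<noteq> y" "x \<noteq> t" "y \<noteq> t" "x \<notin> verts D" "y \<notin> verts D" "t \<notin> verts D"
    using xyt by auto
  have new: "u \<noteq> x" "u \<noteq> y" "u \<noteq> t" if "u \<in> verts D" for u
    using that xyt' by auto
  have "a \<noteq> b" using edge[OF ab] by blast
  have "(a, b) \<in> R" using step[of a b] a g \<open>a \<noteq> b\<close> by auto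
  have asym: False if "(u, v) \<in> R" "(v, u) \<in> R" for u v
    using that R by (meson irrefl_def transD)
  have gb: "g b \<noteq> a"
    using asym[OF \<open>(a, b) \<in> R\<close>] step[of b a] b \<open>a \<noteq> b\<close> by auto
  \<comment> \<open>If \<open>g v = b\<close> as well, \<open>v\<close> and \<open>a\<close> are
    both neighbours of \<open>b = g v = g a\<close>, so each would precede the other.\<close>
  have g_ne_b: "g v \<noteq> b" if v: "v \<in> verts D - outputs D" "v \<noteq> a" for v
  proof
    assume gv: "g v = b"
    have "lab v = XY"
      using YZ[OF v(1)] lab_range[OF v(1)] gv lab by auto
    then have "{v, b} \<in> edges D" using XY[OF v(1)] gv by (simp add: insert_commute)
    then have "(a, v) \<in> R" using step[of a v] a v g by simp
    moreover have "(v, a) \<in> R" using step[of v a] v gv ab by simp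
    ultimately show False by (rule asym)
  qed

  have "labelling ?D ?lab"
    unfolding labelling_def
  proof
    fix v assume v: "v \<in> verts ?D - outputs ?D"
    show "?lab v \<in> {XY, YZ} \<and> (\<exists>\<alpha>. measured ?D v (?lab v) \<alpha>)"
    proof (cases "v \<in> {a, b, x, y, t}")
      case True
      then have "?lab v = XY" using lab by auto
      moreover have "effect ?D v \<in> range (measurement_effect XY)"
        using True by (auto simp del: measurement_effect.simps)
      then obtain \<alpha> where "effect ?D v = measurement_effect XY \<alpha>" by blast
      then have "measured ?D v XY \<alpha>"
        unfolding measured_def using v by (auto intro!: exI[of _ 1])
      ultimately show ?thesis by auto
    next
      case False
      then have "v \<in> verts D - outputs D" "effect ?D v = effect D v" "?lab v = lab v"
        using v by auto
      then show ?thesis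
        using labelling v unfolding labelling_def measured_def by auto
    qed
  qed

  moreover have "?f \<in> verts ?D - outputs ?D \<rightarrow> verts ?D - inputs ?D"
  proof
    fix v assume "v \<in> verts ?D - outputs ?D"
    then show "?f v \<in> verts ?D - inputs ?D"
      using gV[of v] gV[of a] a g io xyt' by auto
  qed

  moreover have "irrefl ((flow_rel ?D ?f)\<^sup>+)"
  proof -
    define \<pi> where "\<pi> v = (if v \<in> {x, y, t} then a else v)" for v
    define idx :: "'v \<Rightarrow> nat" where
      "idx v = (if v = x then 1 else if v = y then 2 else if v = t then 3 else 0)" for v
    \<comment> \<open>A lexicographic order: first \<open>R\<close> on the collapsed vertices, then
      the rank along the path. The default rank 0 puts \<open>a\<close> itself before
      \<open>x\<close>, \<open>y\<close>, \<open>t\<close>.\<close>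
    define S where "S = {(u, v). (\<pi> u, \<pi> v) \<in> R \<or> (\<pi> u = \<pi> v \<and> idx u < idx v)}"
    have "trans S"
      using transD[OF R(1)] unfolding S_def by (intro transI) (auto dest: transD[OF R(1)])
    moreover have "irrefl S"
      using R(2) by (auto simp: S_def irrefl_def)
    moreover have "flow_rel ?D ?f \<subseteq> S"
    proof clarify
      fix u v assume "(u, v) \<in> flow_rel ?D ?f"
      then have uv: "u \<in> verts ?D - outputs D" "v \<noteq> u" "v = ?f u \<or> {v, ?f u} \<in> edges ?D"
        by (auto simp: flow_rel_def nbrs_def)
      have old: "\<pi> v = v" "idx v = 0" if "v \<in> verts D" for v
        using new[OF that] by (auto simp: \<pi>_def idx_def)
      have path: "\<pi> x = a" "\<pi> y = a" "\<pi> t = a" "idx x = 1" "idx y = 2" "idx t = 3"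
        using xyt' by (auto simp: \<pi>_def idx_def)
      have nbr: "{v, x} \<in> edges ?D \<Longrightarrow> v = a \<or> v = y"
        "{v, y} \<in> edges ?D \<Longrightarrow> v = x \<or> v = t"
        "{v, t} \<in> edges ?D \<Longrightarrow> v = y \<or> v = b"
        "{v, b} \<in> edges ?D \<Longrightarrow> v = t \<or> (v \<noteq> a \<and> {v, b} \<in> edges D)"
        using xyt' new[of a] new[of b] a b edge[of v] \<open>a \<noteq> b\<close>
        by (auto simp: doubleton_eq_iff)
      have ab_old: "a \<in> verts D" "b \<in> verts D" using a b by auto
      have f: "?f x = y" "?f y = t" "?f t = b" "?f a = x"
        using xyt' new[of a] ab_old by auto
      consider "u = x" | "u = y" | "u = t" | "u = a" | "u \<in> verts D - outputs D" "u \<noteq> a"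
        using uv(1) by auto
      then show "(u, v) \<in> S"
      proof cases
        case 1
        have "v = y \<or> v = t" using uv(2,3) nbr(2) unfolding 1 f(1) by blast
        with 1 show ?thesis using path by (auto simp: S_def)
      next
        case 2
        have "v = t \<or> v = b" using uv(2,3) nbr(3) unfolding 2 f(2) by blast
        with 2 show ?thesis using path old[OF ab_old(2)] \<open>(a, b) \<in> R\<close> by (auto simp: S_def)
      next
        case 3
        \<comment> \<open>The removal of the edge matters here: were \<open>a\<close> still adjacent
          to \<open>b\<close>, the vertex \<open>t\<close> would have to precede \<open>a\<close>.
          All other neighbours of \<open>b = g a\<close> already come after \<open>a\<close> in
          \<open>R\<close>.\<close>
        have "v = b \<or> (v \<noteq> a \<and> {v, b} \<in> edges D)" using uv(2,3) nbr(4) unfolding 3 f(3) by blast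
        then have "(a, v) \<in> R" "v \<in> verts D"
          using step[of a v] a g \<open>(a, b) \<in> R\<close> edge[of v b] ab_old by auto
        with 3 show ?thesis using path old[of v] by (auto simp: S_def)
      next
        case 4
        have "v = x \<or> v = y" using uv(2,3) nbr(1) unfolding 4 f(4) by blast
        with 4 show ?thesis using path old[OF ab_old(1)] by (auto simp: S_def)
      next
        case 5
        have fu: "?f u = g u" "g u \<in> verts D" "g u \<noteq> b"
          using 5 new[of u] gV[of u] g_ne_b[of u] by auto
        \<comment> \<open>As \<open>g u\<close> is an old vertex other than \<open>b\<close>, its
          only possible new neighbour is \<open>x\<close>, for \<open>g u = a\<close>; and
          \<open>x\<close> has the position of \<open>a\<close>, which comes after
          \<open>u\<close>.\<close>
        have "v = g u \<or> {v, g u} \<in> edges D \<or> (g u = a \<and> v = x)"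
          using uv(3) new[OF fu(2)] fu(3) unfolding fu(1) by (auto simp: doubleton_eq_iff)
        then show ?thesis
        proof (elim disjE)
          assume "g u = a \<and> v = x"
          with 5 step[of u a] show ?thesis using old[of u] path by (auto simp: S_def)
        next
          assume "v = g u"
          with 5 step[of u v] uv(2) show ?thesis using old[of u] old[of v] fu by (auto simp: S_def)
        next
          assume "{v, g u} \<in> edges D"
          with 5 step[of u v] uv(2) edge[of v "g u"] show ?thesis using old[of u] old[of v] by (auto simp: S_def)
        qed
      qed
    qed
    ultimately show ?thesis
      by (metis irrefl_def subsetD trancl_id trancl_mono)
  qed

  moreover have "?f v \<in> nbrs ?D v" if v: "v \<in> verts ?D - outputs ?D" "?lab v = XY" for v
  proof (cases "v \<in> {a, x, y, t}")
    case True
    then show ?thesis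
      using xyt' new[of a] a by (auto simp: nbrs_def insert_commute)
  next
    case False
    then have v': "v \<in> verts D - outputs D" "v \<noteq> a" "lab v = XY" "?f v = g v" using v by auto
    \<comment> \<open>The edge from \<open>v\<close> to its corrector survives the removal: with
      \<open>v \<noteq> a\<close> it could be lost only if \<open>v = b\<close> and
      \<open>g b = a\<close>.\<close>
    have "{g v, v} \<noteq> {a, b}"
      using v' g_ne_b[of v] gb by (auto simp: doubleton_eq_iff)
    then show ?thesis
      unfolding v'(4) using XY[OF v'(1,3)] by (simp add: nbrs_def)
  qed

  moreover have "?f v = v" if v: "v \<in> verts ?D - outputs ?D" "?lab v = YZ" for v
  proof -
    have "v \<notin> {a, x, y, t}" using v(2) lab by (auto split: if_splits)
    then show ?thesis using v YZ[of v] by auto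
  qed

  ultimately show ?thesis
    unfolding extended_causal_flow_def using trans_trancl by blast
qed

section \<open>Equality of interpretations and existence of flow\<close>

theorem lemma23:
  fixes D :: "'v diagram" and a b x y t :: 'v
    and \<alpha>\<^sub>1 \<alpha>\<^sub>2 \<beta>\<^sub>1 \<beta>\<^sub>2 \<beta>\<^sub>3 :: real and z z' :: complex
  assumes "mbqc_form D"
    and "{a, b} \<in> edges D"
    and "measured D a XY \<alpha>\<^sub>1" and "measured D b XY \<alpha>\<^sub>2"
    and "distinct [x, y, t]" and "{x, y, t} \<inter> verts D = {}"
    and "z = - sin ((\<alpha>\<^sub>1 + \<alpha>\<^sub>2) / 2) + \<i> * cos ((\<alpha>\<^sub>1 - \<alpha>\<^sub>2) / 2)"
    and "z' = cos ((\<alpha>\<^sub>1 + \<alpha>\<^sub>2) / 2) - \<i> * sin ((\<alpha>\<^sub>1 - \<alpha>\<^sub>2) / 2)"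
    and "\<beta>\<^sub>1 = (if z' = 0 then 2 * Arg z else if z = 0 then 2 * Arg z' else Arg z + Arg z')
           rmod (2 * pi)"
    and "\<beta>\<^sub>2 = (if z' = 0 then 0 else if z = 0 then pi else 2 * Arg (\<i> + cmod (z / z')))
           rmod (2 * pi)"
    and "\<beta>\<^sub>3 = (if z' = 0 then 0 else if z = 0 then 0 else Arg z - Arg z')
           rmod (2 * pi)"
  shows "same_interp D (edge_to_path D a b x y t \<beta>\<^sub>1 \<beta>\<^sub>2 \<beta>\<^sub>3) \<and>
    (\<forall>lab g. extended_causal_flow D lab g \<and> lab a = XY \<and> lab b = XY \<and> (g a = b \<or> g b = a) \<longrightarrow>
       (\<exists>f. extended_causal_flow (edge_to_path D a b x y t \<beta>\<^sub>1 \<beta>\<^sub>2 \<beta>\<^sub>3)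
              (lab(x := XY, y := XY, t := XY)) f))"
proof (intro conjI allI impI)
  let ?D = "edge_to_path D a b x y t \<beta>\<^sub>1 \<beta>\<^sub>2 \<beta>\<^sub>3"
  obtain ca where ca: "ca \<noteq> 0" "\<And>p. effect D a p = ca * measurement_effect XY \<alpha>\<^sub>1 p"
    using assms(3) unfolding measured_def by blast
  obtain cb where cb: "cb \<noteq> 0" "\<And>p. effect D b p = cb * measurement_effect XY \<alpha>\<^sub>2 p"
    using assms(4) unfolding measured_def by blast
  obtain c where c: "c \<noteq> 0" and kernel:
    "\<And>p q. (\<Sum>i\<in>UNIV. \<Sum>j\<in>UNIV. \<Sum>l\<in>UNIV.
        sgn_edge p i * sgn_edge i j * sgn_edge j l * sgn_edge l q *
        (measurement_effect XY \<beta>\<^sub>1 i * measurement_effect XY \<beta>\<^sub>2 j * measurement_effect XY \<beta>\<^sub>3 l)) =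
      c * (sgn_edge p q * (measurement_effect XY \<alpha>\<^sub>1 p * measurement_effect XY \<alpha>\<^sub>2 q))"
    by (rule path_kernel_eq_edge_kernel[OF assms(7-11) that])
  \<comment> \<open>The scalar is the same for every basis input and every output coordinate, so it
    passes through the linear extension to \<psi>.\<close>
  have "interp ?D \<psi> w = c / (ca * cb) * interp D \<psi> w" for \<psi> w
    unfolding interp_def interp_basis_edge_to_path[OF assms(1-6) kernel ca cb]
    by (simp add: sum_distrib_left mult.left_commute)
  then show "same_interp D ?D"
    unfolding same_interp_def using c ca(1) cb(1) by (auto intro!: exI[of _ "c / (ca * cb)"])
next
  fix lab g
  assume flow: "extended_causal_flow D lab g \<and> lab a = XY \<and> lab b = XY \<and> (g a = b \<or> g b = a)"
  have a: "a \<in> verts D - outputs D" and b: "b \<in> verts D - outputs D"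
    using assms(3,4) by (auto simp: measured_def)
  show "\<exists>f. extended_causal_flow (edge_to_path D a b x y t \<beta>\<^sub>1 \<beta>\<^sub>2 \<beta>\<^sub>3)
              (lab(x := XY, y := XY, t := XY)) f"
  proof (cases "g a = b")
    case True
    then show ?thesis
      using extended_causal_flow_edge_to_path[OF assms(1,2) a b assms(5,6)] flow by blast
  next
    case False
    have "edge_to_path D a b x y t \<beta>\<^sub>1 \<beta>\<^sub>2 \<beta>\<^sub>3 = edge_to_path D b a t y x \<beta>\<^sub>3 \<beta>\<^sub>2 \<beta>\<^sub>1"
      using mbqc_formD(5)[OF assms(1,2)] assms(5,6) by (intro edge_to_path_commute) auto
    moreover have "lab(x := XY, y := XY, t := XY) = lab(t := XY, y := XY, x := XY)"
      by auto
    moreover have "{b, a} \<in> edges D" "distinct [t, y, x]" "{t, y, x} \<inter> verts D = {}"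
      using assms(2,5,6) by (auto simp: insert_commute)
    ultimately show ?thesis
      using extended_causal_flow_edge_to_path[OF assms(1) _ b a, of t y x lab g \<beta>\<^sub>3 \<beta>\<^sub>2 \<beta>\<^sub>1]
        flow False by auto
  qed
qed

end
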